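(* Let $\mathcal{H}$ be a complex Hilbert space, let $A\in\mathcal{B}(\mathcal{H})$ be a positive operator, and let $T\in\mathcal{B}_A(\mathcal{H})$. Then $$w_A(T)\geq\frac{\|T\|_A}{2}+\frac{\big|\,\|\Re_A(T)+\Im_A(T)\|_A-\|\Re_A(T)-\Im_A(T)\|_A\,\big|}{2\sqrt{2}}.$$
   Context: $\mathcal{B}(\mathcal{H})$ is the algebra of bounded linear operators on the complex Hilbert space $\mathcal{H}$ with inner product $\langle\cdot,\cdot\rangle$; $A\in\mathcal{B}(\mathcal{H})$ is positive (i.e. $\langle Ax,x\rangle\ge 0$ for all $x$), not necessarily injective. Put $\langle x,y\rangle_A=\langle Ax,y\rangle$ and $\|x\|_A=\sqrt{\langle x,x\rangle_A}$ (a seminorm on $\mathcal{H}$). $R(S)$ denotes the range of $S$ and $\overline{R(S)}$ its norm closure. $\mathcal{B}_A(\mathcal{H})=\{T\in\mathcal{B}(\mathcal{H}): R(T^*A)\subseteq R(A)\}$, equivalently the set of $T\in\mathcal{B}(\mathcal{H})$ for which there is $S\in\mathcal{B}(\mathcal{H})$ with $AS=T^*A$. For $T\in\mathcal{B}_A(\mathcal{H})$, $T^{\sharp_A}$ denotes the unique $X\in\mathcal{B}(\mathcal{H})$ with $AX=T^*A$ and $R(X)\subseteq\overline{R(A)}$. For $T\in\mathcal{B}_A(\mathcal{H})$: $\|T\|_A=\sup\{\|Tx\|_A: x\in\overline{R(A)},\ \|x\|_A=1\}=\sup\{\|Tx\|_A: x\in\mathcal{H},\ \|x\|_A=1\}$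 (finite), and $w_A(T)=\sup\{|\langle Tx,x\rangle_A|: x\in\mathcal{H},\ \|x\|_A=1\}$. Finally $\Re_A(T)=\frac{T+T^{\sharp_A}}{2}$ and $\Im_A(T)=\frac{T-T^{\sharp_A}}{2\mathrm{i}}$. *)

theory Defs
  imports "HOL-Analysis.Analysis"
begin

text \<open>
  Complex inner product spaces, with the inner product linear in the first argument.  The real
  structure (norm, topology, real inner product) is the one of the library, tied to the complex
  inner product by \<open>inner x y = Re (cinner x y)\<close>; in particular \<open>norm x = sqrt (cinner x x)\<close>
  (lemma \<open>norm_cinner\<close> below).
\<close>

class complex_inner_space = real_inner +
  fixes scaleC :: "complex \<Rightarrow> 'a \<Rightarrow> 'a" (infixr \<open>*\<^sub>C\<close> 75)
    and cinner :: "'a \<Rightarrow> 'a \<Rightarrow> complex"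
  assumes scaleC_add_right: "c *\<^sub>C (x + y) = c *\<^sub>C x + c *\<^sub>C y"
    and scaleC_add_left: "(c + d) *\<^sub>C x = c *\<^sub>C x + d *\<^sub>C x"
    and scaleC_scaleC: "c *\<^sub>C (d *\<^sub>C x) = (c * d) *\<^sub>C x"
    and scaleC_one: "1 *\<^sub>C x = x"
    and scaleR_scaleC: "r *\<^sub>R x = complex_of_real r *\<^sub>C x"
    and cinner_commute: "cinner x y = cnj (cinner y x)"
    and cinner_add_left: "cinner (x + y) z = cinner x z + cinner y z"
    and cinner_scaleC_left: "cinner (c *\<^sub>C x) y = c * cinner x y"
    and inner_eq_Re_cinner: "inner x y = Re (cinner x y)"

class complex_hilbert_space = complex_inner_space + complete_space

lemma cinner_self: "cinner x x = complex_of_real ((norm x)\<^sup>2)"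
proof -
  have "Im (cinner x x) = 0"
    using cinner_commute[of x x] by (simp add: complex_eq_iff)
  then show ?thesis
    by (simp add: complex_eq_iff power2_norm_eq_inner inner_eq_Re_cinner)
qed

lemma norm_cinner: "complex_of_real (norm x) = csqrt (cinner x x)"
  by (simp add: cinner_self)

instantiation complex :: complex_hilbert_space
begin

definition scaleC_complex :: "complex \<Rightarrow> complex \<Rightarrow> complex"
  where "scaleC_complex c x = c * x"

definition cinner_complex :: "complex \<Rightarrow> complex \<Rightarrow> complex"
  where "cinner_complex x y = x * cnj y"

instance
  by standard
    (auto simp: scaleC_complex_def cinner_complex_def inner_complex_def scaleR_conv_of_real
      algebra_simps)

end

definition bounded_clinear :: "('a::complex_inner_space \<Rightarrow> 'a) \<Rightarrow> bool"
  where "bounded_clinear T \<longleftrightarrow> bounded_linear T \<and> (\<forall>c x. T (c *\<^sub>C x) = c *\<^sub>C T x)"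

definition cadjoint :: "('a::complex_hilbert_space \<Rightarrow> 'a) \<Rightarrow> 'a \<Rightarrow> 'a"
  where "cadjoint T = (THE S. \<forall>x y. cinner (T x) y = cinner x (S y))"

definition positive_op :: "('a::complex_inner_space \<Rightarrow> 'a) \<Rightarrow> bool"
  where "positive_op A \<longleftrightarrow> bounded_clinear A \<and> (\<forall>x. cinner (A x) x \<in> \<real>\<^sub>\<ge>\<^sub>0)"

definition inner_A :: "('a::complex_inner_space \<Rightarrow> 'a) \<Rightarrow> 'a \<Rightarrow> 'a \<Rightarrow> complex"
  where "inner_A A x y = cinner (A x) y"

text \<open>For positive \<open>A\<close> the number \<open>inner_A A x x\<close> is a nonnegative real.\<close>

definition norm_A :: "('a::complex_inner_space \<Rightarrow> 'a) \<Rightarrow> 'a \<Rightarrow> real"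
  where "norm_A A x = sqrt (Re (inner_A A x x))"

definition B_A :: "('a::complex_hilbert_space \<Rightarrow> 'a) \<Rightarrow> ('a \<Rightarrow> 'a) set"
  where "B_A A = {T. bounded_clinear T \<and> range (cadjoint T \<circ> A) \<subseteq> range A}"

definition sharp_A :: "('a::complex_hilbert_space \<Rightarrow> 'a) \<Rightarrow> ('a \<Rightarrow> 'a) \<Rightarrow> 'a \<Rightarrow> 'a"
  where "sharp_A A T =
    (THE X. bounded_clinear X \<and> A \<circ> X = cadjoint T \<circ> A \<and> range X \<subseteq> closure (range A))"

text \<open>
  Suprema of sets of nonnegative reals, with \<open>sup {} = 0\<close>.  The empty set occurs exactly when
  \<open>A = 0\<close>, and \<open>Sup {}\<close> is unspecified on the reals.
\<close>

definition sup_nonneg :: "real set \<Rightarrow> real"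
  where "sup_nonneg S = (if S = {} then 0 else Sup S)"

definition opnorm_A :: "('a::complex_hilbert_space \<Rightarrow> 'a) \<Rightarrow> ('a \<Rightarrow> 'a) \<Rightarrow> real"
  where "opnorm_A A T =
    sup_nonneg {norm_A A (T x) | x. x \<in> closure (range A) \<and> norm_A A x = 1}"

definition num_radius_A :: "('a::complex_hilbert_space \<Rightarrow> 'a) \<Rightarrow> ('a \<Rightarrow> 'a) \<Rightarrow> real"
  where "num_radius_A A T = sup_nonneg {cmod (inner_A A (T x) x) | x. norm_A A x = 1}"

definition Re_A :: "('a::complex_hilbert_space \<Rightarrow> 'a) \<Rightarrow> ('a \<Rightarrow> 'a) \<Rightarrow> 'a \<Rightarrow> 'a"
  where "Re_A A T x = (1 / 2) *\<^sub>C (T x + sharp_A A T x)"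

definition Im_A :: "('a::complex_hilbert_space \<Rightarrow> 'a) \<Rightarrow> ('a \<Rightarrow> 'a) \<Rightarrow> 'a \<Rightarrow> 'a"
  where "Im_A A T x = (1 / (2 * \<i>)) *\<^sub>C (T x - sharp_A A T x)"

end

theory Submission
  imports Defs
begin

text \<open>
  Put \<open>c = (1 + \<i>) / 2\<close>.  Then \<open>\<Re>\<^sub>A(T) + \<Im>\<^sub>A(T) = P\<close> and \<open>\<Re>\<^sub>A(T) - \<Im>\<^sub>A(T) = Q\<close>, where
  \<open>P = cnj c T + c T\<^sup>\<sharp>\<close> and \<open>Q = c T + cnj c T\<^sup>\<sharp>\<close> are symmetric for the semi-inner product of \<open>A\<close>.
  Their quadratic forms are bounded by \<open>\<surd>2 \<bar>\<langle>Tx, x\<rangle>\<^sub>A\<bar>\<close>, and by polarization their seminorms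
  are at most \<open>\<surd>2 w\<^sub>A(T)\<close>.  On the other hand \<open>T = c P + cnj c Q\<close> gives
  \<open>\<surd>2 \<parallel>T\<parallel>\<^sub>A \<le> \<parallel>P\<parallel>\<^sub>A + \<parallel>Q\<parallel>\<^sub>A\<close>, and the larger of two numbers is half their sum plus half
  their distance.
\<close>

section \<open>Boundedness through Baire category\<close>

text \<open>The closed sublevel sets cover the space, so by Baire's theorem one of them contains a
  ball; linearity carries the bound to a ball around 0.\<close>

lemma bounded_linear_if_closed_sublevels:
  fixes f :: "'a::{real_normed_vector, complete_space} \<Rightarrow> 'b::real_normed_vector"
  assumes "linear f" and closed: "\<And>n::nat. closed {x. norm (f x) \<le> real n}"
  shows "bounded_linear f"
proof -
  interpret linear f by fact
  let ?S = "\<lambda>n::nat. {x. norm (f x) \<le> real n}"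
  have "\<exists>n. interior (?S n) \<noteq> {}"
  proof (rule ccontr)
    assume "\<not> ?thesis"
    then have int: "interior (?S n) = {}" for n
      by blast
    have "Met_TC.mcomplete TYPE('a)"
      unfolding Met_TC.mcomplete_def by (auto simp: Cauchy_convergent_iff convergent_def)
    then have "Met_TC.mtopology interior_of \<Union>(range ?S) = {}"
      by (rule Met_TC.metric_Baire_category_alt) (use int closed in auto)
    moreover have "\<Union>(range ?S) = UNIV"
      by (auto intro: real_arch_simple)
    ultimately show False
      by simp
  qed
  then obtain n a where "a \<in> interior (?S n)"
    by blast
  then obtain e where e: "e > 0" "ball a e \<subseteq> ?S n"
    by (auto simp: mem_interior)
  have small: "norm (f y) \<le> 2 * n" if "norm y < e" for y
  proof -
    have "a + y \<in> ?S n" "a \<in> ?S n"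
      using e that by (auto simp: dist_norm subset_iff)
    then show ?thesis
      using norm_triangle_ineq4[of "f (a + y)" "f a"] by (simp add: add)
  qed
  have "norm (f x) \<le> norm x * (4 * n / e)" for x
  proof (cases "x = 0")
    case False
    let ?c = "e / (2 * norm x)"
    have "norm (f (?c *\<^sub>R x)) \<le> 2 * n"
      by (rule small) (use e False in simp)
    then have "e * norm (f x) / (2 * norm x) \<le> 2 * n"
      using e(1) by (simp add: scale)
    then have "e * norm (f x) \<le> 4 * n * norm x"
      using False by (simp add: divide_le_eq)
    then show ?thesis
      using e(1) by (simp add: le_divide_eq mult.commute)
  qed (simp add: zero)
  then show ?thesis
    by (rule bounded_linear_intro[OF add scale])
qed

section \<open>Projections and the Riesz theorem in real Hilbert spaces\<close>

text \<open>A sequence in \<open>M\<close> minimizing the distance to \<open>x\<close> is Cauchy by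
  the parallelogram law; at its limit \<open>p\<close>, moving along a vector of \<open>M\<close>
  cannot shorten \<open>x - p\<close>, which forces orthogonality.\<close>

lemma ex_orthogonal_projection:
  fixes M :: "'a::{real_inner, complete_space} set"
  assumes "subspace M" "closed M"
  shows "\<exists>p\<in>M. \<forall>m\<in>M. inner (x - p) m = 0"
proof -
  define D where "D = (\<lambda>m. (norm (x - m))\<^sup>2) ` M"
  define d where "d = Inf D"
  have D: "D \<noteq> {}" "bdd_below D"
    using subspace_0[OF assms(1)] by (auto simp: D_def intro!: bdd_belowI[of _ 0])
  have d_le: "d \<le> (norm (x - m))\<^sup>2" if "m \<in> M" for m
    unfolding d_def by (rule cInf_lower) (use that D in \<open>auto simp: D_def\<close>)
  have "\<exists>m\<in>M. (norm (x - m))\<^sup>2 < d + inverse (real (Suc n))" for n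
  proof -
    have "Inf D < d + inverse (real (Suc n))"
      by (simp add: d_def)
    then show ?thesis
      using D by (subst (asm) cInf_less_iff) (auto simp: D_def)
  qed
  then obtain m where mM: "\<And>n. m n \<in> M"
    and m: "\<And>n. (norm (x - m n))\<^sup>2 < d + inverse (real (Suc n))"
    by metis
  \<comment> \<open>Parallelogram law for \<open>x - u\<close> and \<open>x - v\<close>: the
    midpoint of \<open>u\<close> and \<open>v\<close> is in \<open>M\<close>, so its squared
    distance from \<open>x\<close> is at least \<open>d\<close>.\<close>
  have mid: "(norm (u - v))\<^sup>2 \<le> 2 * (norm (x - u))\<^sup>2 + 2 * (norm (x - v))\<^sup>2 - 4 * d"
    if "u \<in> M" "v \<in> M" for u v
  proof -
    have "(1/2) *\<^sub>R (u + v) \<in> M"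
      using that assms(1) by (simp add: subspace_add subspace_scale)
    from d_le[OF this] show ?thesis
      by (simp add: power2_norm_eq_inner inner_simps inner_commute algebra_simps)
  qed
  have "Cauchy m"
  proof (rule metric_CauchyI)
    fix e :: real
    assume "e > 0"
    then have "e\<^sup>2 / 4 > 0" by simp
    then obtain N where N: "inverse (real (Suc N)) < e\<^sup>2 / 4"
      using reals_Archimedean by blast
    have "dist (m i) (m j) < e" if "i \<ge> N" "j \<ge> N" for i j
    proof -
      have "inverse (real (Suc i)) \<le> inverse (real (Suc N))"
        "inverse (real (Suc j)) \<le> inverse (real (Suc N))"
        using that by (auto intro!: le_imp_inverse_le)
      with mid[OF mM mM, of i j] m[of i] m[of j] N have "(norm (m i - m j))\<^sup>2 < e\<^sup>2"
        by linarith
      then show ?thesis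
        using \<open>e > 0\<close> by (simp add: dist_norm power2_less_imp_less)
    qed
    then show "\<exists>N. \<forall>i\<ge>N. \<forall>j\<ge>N. dist (m i) (m j) < e"
      by blast
  qed
  then obtain p where p: "m \<longlonglongrightarrow> p"
    by (auto simp: Cauchy_convergent_iff convergent_def)
  have "p \<in> M"
    using closed_sequentially[OF assms(2)] mM p by blast
  have "(\<lambda>n. d + inverse (real (Suc n))) \<longlonglongrightarrow> d + 0"
    by (intro tendsto_intros LIMSEQ_inverse_real_of_nat)
  moreover have "(\<lambda>n. (norm (x - m n))\<^sup>2) \<longlonglongrightarrow> (norm (x - p))\<^sup>2"
    by (intro tendsto_intros p)
  ultimately have p_le: "(norm (x - p))\<^sup>2 \<le> d"
    using m by (intro LIMSEQ_le) (auto intro: less_imp_le)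
  have "inner (x - p) v = 0" if "v \<in> M" for v
  proof (cases "v = 0")
    case False
    define t where "t = inner (x - p) v / inner v v"
    have "p + t *\<^sub>R v \<in> M"
      using \<open>p \<in> M\<close> that assms(1) by (simp add: subspace_add subspace_scale)
    from order_trans[OF p_le d_le[OF this]]
    have "(norm (x - p))\<^sup>2 \<le> (norm ((x - p) - t *\<^sub>R v))\<^sup>2"
      by (simp only: diff_diff_eq)
    then have "2 * t * inner (x - p) v \<le> t * (t * inner v v)"
      unfolding power2_norm_eq_inner inner_diff_left[of "x - p"] inner_diff_right[of _ "x - p"]
      using inner_commute[of v x] inner_commute[of v p] by (simp add: algebra_simps)
    also have "t * inner v v = inner (x - p) v"
      using False by (simp add: t_def)
    finally have "t * inner (x - p) v \<le> 0"
      by simp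
    then have "(inner (x - p) v)\<^sup>2 \<le> 0"
      using False inner_gt_zero_iff[of v]
      by (auto simp: t_def power2_eq_square divide_le_0_iff simp del: inner_gt_zero_iff)
    then show ?thesis by simp
  qed simp
  with \<open>p \<in> M\<close> show ?thesis by blast
qed

text \<open>A nonzero \<open>r\<close> orthogonal to the kernel represents \<open>f\<close> up to a
  factor, since \<open>x - (f x / f r) *\<^sub>R r\<close> lies in the kernel for every
  \<open>x\<close>.\<close>

lemma Riesz_representation:
  fixes f :: "'a::{real_inner, complete_space} \<Rightarrow> real"
  assumes "bounded_linear f"
  shows "\<exists>s. \<forall>x. f x = inner x s"
proof (cases "\<forall>x. f x = 0")
  case False
  interpret bounded_linear f by fact
  let ?K = "{x. f x = 0}"
  from False obtain z where "f z \<noteq> 0" by blast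
  have "subspace ?K"
    by (auto simp: subspace_def add scaleR zero)
  moreover have "closed ?K"
    by (intro closed_Collect_eq continuous_on continuous_on_id continuous_on_const)
  ultimately obtain p where p: "f p = 0" "\<And>m. f m = 0 \<Longrightarrow> inner (z - p) m = 0"
    using ex_orthogonal_projection[of ?K z] by auto
  define r where "r = z - p"
  have fr: "f r \<noteq> 0"
    using \<open>f z \<noteq> 0\<close> p by (simp add: r_def diff)
  then have "r \<noteq> 0"
    using zero by auto
  have "f x = inner x ((f r / inner r r) *\<^sub>R r)" for x
  proof -
    have "inner r (x - (f x / f r) *\<^sub>R r) = 0"
      unfolding r_def by (rule p(2)) (use fr in \<open>simp add: diff scaleR flip: r_def\<close>)
    then show ?thesis
      using fr \<open>r \<noteq> 0\<close> by (simp add: inner_simps inner_commute[of x r] field_simps)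
  qed
  then show ?thesis by blast
qed (auto intro: exI[of _ 0])

section \<open>Semi-inner products of positive symmetric operators\<close>

text \<open>A real setting is enough, because \<open>norm_A\<close> sees only the real part of
  \<open>inner_A\<close>. \<open>A\<close> may have a kernel, so \<open>snorm\<close> is only a
  seminorm and null vectors need separate cases.\<close>

locale semi_inner =
  fixes A :: "'a::real_inner \<Rightarrow> 'a"
  assumes bl: "bounded_linear A"
    and sym: "inner (A x) y = inner x (A y)"
    and nonneg: "inner (A x) x \<ge> 0"
begin

sublocale bounded_linear A by (rule bl)

definition snorm :: "'a \<Rightarrow> real"
  where "snorm x = sqrt (inner (A x) x)"

lemma snorm_nonneg: "snorm x \<ge> 0"
  by (simp add: snorm_def nonneg)

lemma snorm_square: "(snorm x)\<^sup>2 = inner (A x) x"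
  by (simp add: snorm_def nonneg)

lemma commute: "inner (A x) y = inner (A y) x"
  by (metis sym inner_commute)

lemma square_add: "inner (A (x + y)) (x + y) = inner (A x) x + 2 * inner (A x) y + inner (A y) y"
  using commute[of x y] by (simp add: add inner_simps)

lemma snorm_scaleR: "snorm (r *\<^sub>R x) = \<bar>r\<bar> * snorm x"
  by (simp add: snorm_def scaleR real_sqrt_mult flip: mult.assoc)

lemma Cauchy_Schwarz: "inner (A x) y \<le> snorm x * snorm y"
proof -
  have q: "0 \<le> inner (A x) x + 2 * t * inner (A x) y + t\<^sup>2 * inner (A y) y" for t
    using nonneg[of "x + t *\<^sub>R y"] 
      unfolding square_add by (simp add: scaleR power2_eq_square algebra_simps)
  let ?b = "inner (A x) y" and ?c = "inner (A y) y"
  have "?b\<^sup>2 \<le> inner (A x) x * ?c"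
  proof (cases "?c = 0")
    case True
    \<comment> \<open>With \<open>?c = 0\<close> the expression in \<open>q\<close> is affine in
      \<open>t\<close>, and for \<open>?b \<noteq> 0\<close> the chosen \<open>t\<close> gives it
      the value -1.\<close>
    then have "?b = 0"
      using q[of "- (inner (A x) x + 1) / (2 * ?b)"] nonneg[of x]
      by (cases "?b = 0") (auto simp: field_simps)
    then show ?thesis
      by (simp add: nonneg)
  next
    case False
    then have "?c > 0"
      using nonneg[of y] by simp
    then show ?thesis
      using q[of "- ?b / ?c"] by (simp add: field_simps power2_eq_square)
  qed
  then have "?b\<^sup>2 \<le> (snorm x * snorm y)\<^sup>2"
    by (simp add: power_mult_distrib snorm_square)
  then show ?thesis
    by (rule power2_le_imp_le) (simp add: snorm_nonneg)
qed

lemma Cauchy_Schwarz_abs: "\<bar>inner (A x) y\<bar> \<le> snorm x * snorm y"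
  using Cauchy_Schwarz[of x y] Cauchy_Schwarz[of x "- y"] snorm_scaleR[of "-1" y] by simp

lemma snorm_triangle: "snorm (x + y) \<le> snorm x + snorm y"
proof (rule power2_le_imp_le)
  show "(snorm (x + y))\<^sup>2 \<le> (snorm x + snorm y)\<^sup>2"
    using Cauchy_Schwarz[of x y] by (simp add: snorm_square square_add power2_sum)
qed (simp add: snorm_nonneg)

lemma snorm_normalize: "snorm x \<noteq> 0 \<Longrightarrow> snorm (inverse (snorm x) *\<^sub>R x) = 1"
  by (simp add: snorm_scaleR snorm_nonneg)

lemma snorm_le_norm: "\<exists>C\<ge>0. \<forall>x. snorm x \<le> C * norm x"
proof -
  obtain L where L: "L \<ge> 0" "\<And>x. norm (A x) \<le> norm x * L"
    using nonneg_bounded by blast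
  have "snorm x \<le> sqrt L * norm x" for x
  proof (rule power2_le_imp_le)
    have "inner (A x) x \<le> norm (A x) * norm x"
      by (rule norm_cauchy_schwarz)
    also have "\<dots> \<le> norm x * L * norm x"
      by (intro mult_right_mono L norm_ge_zero)
    finally show "(snorm x)\<^sup>2 \<le> (sqrt L * norm x)\<^sup>2"
      using L by (simp add: snorm_square power_mult_distrib power2_eq_square[of "norm x"] ac_simps)
  qed (use L in simp)
  with L show ?thesis
    by (intro exI[of _ "sqrt L"]) auto
qed

text \<open>
  The inequality \<open>\<parallel>P\<^sup>n x\<parallel>\<^sup>2 \<le> \<parallel>P\<^sup>2\<^sup>n x\<parallel> \<parallel>x\<parallel>\<close>, iterated along powers of two, shows that a bound of \<open>P\<close>
  in the norm of the space is also a bound in the seminorm.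
\<close>

lemma symmetric_snorm_bounded:
  assumes P: "bounded_linear P" and Psym: "\<And>x y. inner (A (P x)) y = inner (A x) (P y)"
  shows "\<exists>K\<ge>0. \<forall>x. snorm (P x) \<le> K * snorm x"
proof -
  interpret P: bounded_linear P by fact
  obtain K where K: "K > 0" "\<And>x. norm (P x) \<le> norm x * K"
    using P.pos_bounded by blast
  obtain C where C: "C \<ge> 0" "\<And>x. snorm x \<le> C * norm x"
    using snorm_le_norm by blast
  have normP: "norm ((P ^^ n) x) \<le> K ^ n * norm x" for n x
  proof (induction n)
    case (Suc n)
    have "norm ((P ^^ Suc n) x) \<le> norm ((P ^^ n) x) * K"
      using K by simp
    also have "\<dots> \<le> K ^ n * norm x * K"
      using Suc K by (intro mult_right_mono) auto
    finally show ?case by (simp add: mult_ac)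
  qed simp
  have Psym_n: "inner (A ((P ^^ n) x)) y = inner (A x) ((P ^^ n) y)" for n x y
    by (induction n arbitrary: x y) (auto simp: Psym funpow_swap1)
  have double: "(snorm ((P ^^ n) x))\<^sup>2 \<le> snorm ((P ^^ (2 * n)) x) * snorm x" for n x
    using Cauchy_Schwarz[of "(P ^^ (2 * n)) x" x]
    by (simp add: snorm_square mult_2 funpow_add Psym_n[of n "(P ^^ n) x" x])
  have unit: "snorm (P x) \<le> K" if "snorm x = 1" for x
  proof (rule ccontr)
    assume "\<not> snorm (P x) \<le> K"
    \<comment> \<open>Dividing by \<open>K\<close> cancels the growth \<open>K ^ (2 ^ k)\<close> of
      the norm bound: all powers \<open>r ^ (2 ^ k)\<close> would be at most
      \<open>C * norm x\<close> although \<open>r > 1\<close>.\<close>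
    define r where "r = snorm (P x) / K"
    have r: "r > 1"
      using \<open>\<not> snorm (P x) \<le> K\<close> K by (simp add: r_def)
    have "snorm (P x) ^ (2 ^ k) \<le> snorm ((P ^^ (2 ^ k)) x)" for k
    proof (induction k)
      case (Suc k)
      have "snorm (P x) ^ (2 ^ Suc k) = (snorm (P x) ^ (2 ^ k))\<^sup>2"
        by (metis power_Suc2 power_mult)
      also have "\<dots> \<le> (snorm ((P ^^ (2 ^ k)) x))\<^sup>2"
        by (intro power_mono Suc) (simp add: snorm_nonneg)
      also have "\<dots> \<le> snorm ((P ^^ (2 ^ Suc k)) x)"
        using double[of "2 ^ k" x] that by simp
      finally show ?case .
    qed simp
    moreover have "snorm ((P ^^ (2 ^ k)) x) \<le> C * (K ^ (2 ^ k) * norm x)" for k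
      using C normP by (meson mult_left_mono order_trans)
    ultimately have "snorm (P x) ^ (2 ^ k) \<le> C * (K ^ (2 ^ k) * norm x)" for k
      using order_trans by blast
    then have le: "r ^ (2 ^ k) \<le> C * norm x" for k
    proof -
      have "r ^ (2 ^ k) = snorm (P x) ^ (2 ^ k) / K ^ (2 ^ k)"
        by (simp add: r_def power_divide)
      also have "\<dots> \<le> C * (K ^ (2 ^ k) * norm x) / K ^ (2 ^ k)"
        using K \<open>snorm (P x) ^ (2 ^ k) \<le> C * (K ^ (2 ^ k) * norm x)\<close> by (intro divide_right_mono) auto
      also have "\<dots> = C * norm x"
        using K by simp
      finally show ?thesis .
    qed
    obtain k where "C * norm x < r ^ k"
      using real_arch_pow[OF r] by blast
    also have "r ^ k \<le> r ^ (2 ^ k)"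
      using r by (intro power_increasing) auto
    finally show False
      using le[of k] by simp
  qed
  have "snorm (P x) \<le> K * snorm x" for x
  proof (cases "snorm x = 0")
    case True
    \<comment> \<open>\<open>P\<close> maps null vectors to null vectors: \<open>double\<close> with
      \<open>n = 1\<close> bounds the square by 0.\<close>
    then show ?thesis
      using double[of 1 x] by simp
  next
    case False
    then have "snorm (P (inverse (snorm x) *\<^sub>R x)) \<le> K"
      by (intro unit snorm_normalize)
    then show ?thesis
      using False snorm_nonneg[of x]
      by (simp add: P.scaleR snorm_scaleR field_simps)
  qed
  with K show ?thesis
    by (intro exI[of _ K]) auto
qed

text \<open>Polarization between \<open>x\<close> and a multiple \<open>y\<close> of
  \<open>P x\<close>: symmetry turns \<open>4 * inner (A (P x)) y\<close> into a difference of
  quadratic forms, and the parallelogram law sums their bounds.\<close>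

lemma symmetric_snorm_le_quadratic_form:
  assumes P: "bounded_linear P" and Psym: "\<And>x y. inner (A (P x)) y = inner (A x) (P y)"
    and m: "\<And>z. \<bar>inner (A (P z)) z\<bar> \<le> m * (snorm z)\<^sup>2"
  shows "snorm (P x) \<le> m * snorm x"
proof (cases "snorm x = 0 \<or> snorm (P x) = 0")
  case True
  show ?thesis
  proof (cases "snorm x = 0")
    case True
    \<comment> \<open>Rescaling is impossible at a null vector; the seminorm bound of
      \<open>P\<close> shows that \<open>P x\<close> is null too.\<close>
    obtain K where "snorm (P x) \<le> K * snorm x"
      using symmetric_snorm_bounded[OF P Psym] by blast
    with True show ?thesis by simp
  next
    case False
    then have "0 \<le> m"
      using order_trans[OF abs_ge_zero m[of x]] by (simp add: zero_le_mult_iff)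
    then show ?thesis
      using True False by (simp add: snorm_nonneg)
  qed
next
  case False
  interpret P: bounded_linear P by fact
  let ?n = "snorm x" and ?k = "snorm (P x)"
  have pos: "?n > 0" "?k > 0"
    using False snorm_nonneg[of x] snorm_nonneg[of "P x"] by auto
  \<comment> \<open>Scaling \<open>P x\<close> to the seminorm of \<open>x\<close> makes the
    polarized term \<open>4 * ?n * ?k\<close> and its bound
    \<open>4 * m * ?n\<^sup>2\<close>.\<close>
  define y where "y = (?n / ?k) *\<^sub>R P x"
  have y: "snorm y = ?n"
    using pos by (simp add: y_def snorm_scaleR)
  have Pyx: "inner (A (P y)) x = inner (A (P x)) y"
    using Psym[of y x] commute[of "P x" y] by simp
  have "4 * inner (A (P x)) y
    = inner (A (P (x + y))) (x + y) - inner (A (P (x - y))) (x - y)"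
    using Pyx by (simp add: P.add P.diff add diff inner_simps)
  also have "\<dots> \<le> m * (snorm (x + y))\<^sup>2 + m * (snorm (x - y))\<^sup>2"
    using m[of "x + y"] m[of "x - y"] by linarith
  also have "\<dots> = m * (2 * (snorm x)\<^sup>2 + 2 * (snorm y)\<^sup>2)"
    unfolding snorm_square by (simp add: add diff inner_simps algebra_simps)
  finally have "inner (A (P x)) y \<le> m * ?n\<^sup>2"
    by (simp add: y)
  moreover have "inner (A (P x)) y = ?n * ?k"
    using pos by (simp add: y_def flip: snorm_square) (simp add: power2_eq_square)
  ultimately show ?thesis
    using pos by (simp add: power2_eq_square)
qed

end

section \<open>Complex inner products, adjoints and positive operators\<close>

lemma cinner_add_right: "cinner x (y + z) = cinner x y + cinner x z"
  by (metis cinner_add_left cinner_commute complex_cnj_add)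

lemma cinner_scaleC_right: "cinner x (c *\<^sub>C y) = cnj c * cinner x y"
  by (metis cinner_scaleC_left cinner_commute complex_cnj_mult)

lemma scaleC_minus_right: "c *\<^sub>C (- x) = - (c *\<^sub>C x)" for x :: "'a::complex_inner_space"
proof -
  have "c *\<^sub>C (0::'a) = 0"
    using scaleC_add_right[of c 0 "0::'a"] by simp
  then show ?thesis
    using scaleC_add_right[of c x "- x"] by (simp add: eq_neg_iff_add_eq_0 add.commute)
qed

lemma scaleC_diff_right: "c *\<^sub>C (x - y) = c *\<^sub>C x - c *\<^sub>C y" for x :: "'a::complex_inner_space"
  using scaleC_add_right[of c x "- y"] by (simp add: scaleC_minus_right)

lemma cinner_minus_left: "cinner (- x) y = - cinner x y"
proof -
  have "cinner 0 y = 0"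
    using cinner_add_left[of 0 0 y] by simp
  then show ?thesis
    using cinner_add_left[of x "- x" y] by (simp add: eq_neg_iff_add_eq_0 add.commute)
qed

lemma cinner_diff_left: "cinner (x - y) z = cinner x z - cinner y z"
  using cinner_add_left[of x "- y" z] by (simp add: cinner_minus_left)

lemma cinner_ext_left: "x = x'" if "\<And>y. cinner x y = cinner x' y"
proof -
  have "inner (x - x') (x - x') = 0"
    using that by (simp add: inner_eq_Re_cinner cinner_diff_left)
  then show ?thesis by simp
qed

lemma cinner_ext_right: "x = x'" if "\<And>y. cinner y x = cinner y x'"
  proof (rule cinner_ext_left)
  show "cinner x y = cinner x' y" for y
    using that[of y] cinner_commute[of x y] cinner_commute[of x' y] by simp
qed

lemma norm_scaleC: "norm (c *\<^sub>C x) = cmod c * norm x" for x :: "'a::complex_inner_space"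
proof -
  have "cinner (c *\<^sub>C x) (c *\<^sub>C x) = (c * cnj c) * cinner x x"
    by (simp add: cinner_scaleC_left cinner_scaleC_right)
  then have "complex_of_real ((norm (c *\<^sub>C x))\<^sup>2) = complex_of_real ((cmod c * norm x)\<^sup>2)"
    unfolding cinner_self complex_norm_square[symmetric] by (simp add: power_mult_distrib)
  then show ?thesis
    unfolding of_real_eq_iff by (simp add: power2_eq_iff_nonneg)
qed

lemma bounded_linear_scaleC: "bounded_linear (\<lambda>x::'a::complex_inner_space. c *\<^sub>C x)"
  by (rule bounded_linear_intro[where K = "cmod c"])
    (simp_all add: scaleC_add_right scaleR_scaleC scaleC_scaleC norm_scaleC mult.commute)

text \<open>Riesz yields an adjoint for the real inner product; complex linearity of
  \<open>T\<close> extends the identity to imaginary parts, and nondegeneracy identifies this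
  operator with \<open>cadjoint T\<close>.\<close>

lemma bounded_clinear_cinner_cadjoint:
  fixes T :: "'a::complex_hilbert_space \<Rightarrow> 'a"
  assumes "bounded_clinear T"
  shows "cinner (T x) y = cinner x (cadjoint T y)"
proof -
  define S where "S y = (SOME s. \<forall>x. inner (T x) y = inner x s)" for y
  have bl: "bounded_linear T" and TC: "T (c *\<^sub>C x) = c *\<^sub>C T x" for c x
    using assms by (simp_all add: bounded_clinear_def)
  have "\<forall>x. inner (T x) y = inner x (S y)" for y
  proof -
    have "bounded_linear (\<lambda>x. inner (T x) y)"
      using bl by (rule bounded_linear_inner_left_comp)
    then have "\<exists>s. \<forall>x. inner (T x) y = inner x s"
      by (rule Riesz_representation)
    then show ?thesis
      unfolding S_def by (rule someI_ex)
  qed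
  then have S: "Re (cinner (T x) y) = Re (cinner x (S y))" for x y
    by (simp flip: inner_eq_Re_cinner)
  have S_cinner: "cinner (T x) y = cinner x (S y)" for x y
  proof (rule complex_eqI)
    \<comment> \<open>The real part at \<open>\<i> *\<^sub>C x\<close> is minus the imaginary part
      at \<open>x\<close>.\<close>
    show "Im (cinner (T x) y) = Im (cinner x (S y))"
      using S[of "\<i> *\<^sub>C x" y] by (simp add: TC cinner_scaleC_left)
  qed (rule S)
  have "cadjoint T = S"
    unfolding cadjoint_def
  proof (rule the_equality)
    show "\<forall>x y. cinner (T x) y = cinner x (S y)"
      using S_cinner by blast
  next
    fix S' assume S': "\<forall>x y. cinner (T x) y = cinner x (S' y)"
    show "S' = S"
    proof (intro ext)
      fix y
      have "cinner x (S' y) = cinner x (S y)" for x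
        by (rule trans[OF S'[rule_format, symmetric] S_cinner])
      then show "S' y = S y"
        by (rule cinner_ext_right)
    qed
  qed
  with S_cinner show ?thesis
    by metis
qed

text \<open>Positivity makes the form real on the diagonal; polarizing at \<open>x + y\<close>
  settles the imaginary parts and at \<open>x + \<i> *\<^sub>C y\<close> the real parts.\<close>

lemma positive_op_cinner_commute:
  assumes "positive_op A"
  shows "cinner (A x) y = cnj (cinner (A y) x)"
proof -
  interpret bounded_linear A
    using assms by (simp add: positive_op_def bounded_clinear_def)
  have C: "A (c *\<^sub>C x) = c *\<^sub>C A x" for c x
    using assms by (simp add: positive_op_def bounded_clinear_def)
  have real: "Im (cinner (A x) x) = 0" for x
    using assms by (auto simp: positive_op_def complex_nonneg_Reals_iff)
  have "Im (cinner (A x) y) + Im (cinner (A y) x) = 0"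
    using real[of "x + y"] real[of x] real[of y]
    by (simp add: add cinner_add_left cinner_add_right)
  moreover have "Re (cinner (A y) x) - Re (cinner (A x) y) = 0"
    using real[of "x + \<i> *\<^sub>C y"] real[of x] real[of y]
    by (simp add: add cinner_add_left cinner_add_right C cinner_scaleC_left cinner_scaleC_right)
  ultimately show ?thesis
    by (simp add: complex_eq_iff)
qed

lemma positive_op_symmetric:
  assumes "positive_op A"
  shows "cinner (A x) y = cinner x (A y)"
  using positive_op_cinner_commute[OF assms, of x y] cinner_commute[of x "A y"] by simp

lemma positive_op_semi_inner:
  assumes "positive_op A"
  shows "semi_inner A"
proof (rule semi_inner.intro)
  show "bounded_linear A"
    using assms by (simp add: positive_op_def bounded_clinear_def)
  show "inner (A x) y = inner x (A y)" for x y
    by (simp add: inner_eq_Re_cinner positive_op_symmetric[OF assms])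
  show "0 \<le> inner (A x) x" for x
    using assms by (auto simp: inner_eq_Re_cinner positive_op_def complex_nonneg_Reals_iff)
qed

lemma norm_A_eq_snorm: "positive_op A \<Longrightarrow> norm_A A x = semi_inner.snorm A x"
  by (simp add: norm_A_def inner_A_def semi_inner.snorm_def[OF positive_op_semi_inner]
      inner_eq_Re_cinner)

text \<open>The range of a symmetric operator, and by continuity its closure, is orthogonal to the
  kernel, where \<open>u - v\<close> lies. This is the uniqueness behind
  \<open>sharp_A\<close>.\<close>

lemma positive_op_inj_on_closure_range:
  assumes "positive_op A" and "A u = A v" and "u \<in> closure (range A)" "v \<in> closure (range A)"
  shows "u = v"
proof -
  interpret semi_inner A
    using assms(1) by (rule positive_op_semi_inner)
  have "closure (range A) \<subseteq> {w. inner w (u - v) = 0}"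
    by (rule closure_minimal)
      (auto simp: sym diff assms(2) intro!: closed_Collect_eq continuous_intros)
  with assms(3,4) have "inner u (u - v) = 0" "inner v (u - v) = 0"
    by blast+
  then have "inner (u - v) (u - v) = 0"
    by (simp only: inner_diff_left[of u v])
  then show ?thesis by simp
qed

section \<open>The sharp operator as an adjoint for \<open>inner_A\<close>\<close>

lemma subspace_closure:
  fixes S :: "'a::real_normed_vector set"
  assumes "subspace S"
  shows "subspace (closure S)"
  unfolding subspace_def
proof (intro conjI ballI allI)
  show "0 \<in> closure S"
    using assms closure_subset subspace_0 by blast
next
  fix x y assume "x \<in> closure S" "y \<in> closure S"
  then have "x + y \<in> closure (S + S)"
    by (intro subsetD[OF closure_sum] set_plus_intro)
  also have "\<dots> \<subseteq> closure S"
    using assms by (intro closure_mono) (auto simp: set_plus_def subspace_add)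
  finally show "x + y \<in> closure S" .
next
  fix c x assume "x \<in> closure S"
  then have "c *\<^sub>R x \<in> closure ((*\<^sub>R) c ` S)"
    by (intro subsetD[OF closure_bounded_linear_image_subset] bounded_linear_scaleR_right imageI)
  also have "\<dots> \<subseteq> closure S"
    using assms by (intro closure_mono) (auto simp: subspace_scale)
  finally show "c *\<^sub>R x \<in> closure S" .
qed

text \<open>
  The solution \<open>X\<close> of \<open>A X = T\<^sup>* A\<close> with range in \<open>closure (range A)\<close> is bounded because
  \<open>\<langle>X y, A z\<rangle> = \<langle>y, A T z\<rangle>\<close> makes the sets \<open>{y. \<parallel>X y\<parallel> \<le> n}\<close> closed.
\<close>

lemma bounded_clinear_sharp:
  assumes pos: "positive_op A" and T: "T \<in> B_A A"
  shows "bounded_clinear (sharp_A A T)" and "A (sharp_A A T x) = cadjoint T (A x)"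
proof -
  interpret semi_inner A
    using pos by (rule positive_op_semi_inner)
  let ?R = "closure (range A)"
  have AC: "A (c *\<^sub>C x) = c *\<^sub>C A x" for c x
    using pos by (simp add: positive_op_def bounded_clinear_def)
  have bT: "bounded_clinear T" and range: "range (cadjoint T \<circ> A) \<subseteq> range A"
    using T by (auto simp: B_A_def)
  note adj = bounded_clinear_cinner_cadjoint[OF bT]
  have subspace: "subspace ?R"
    by (intro subspace_closure linear_subspace_image subspace_UNIV bounded_linear.linear bl)
  have "\<exists>u\<in>?R. A u = cadjoint T (A y)" for y
  proof -
    obtain z where z: "A z = cadjoint T (A y)"
      using subsetD[OF range, of "cadjoint T (A y)"] by auto
    \<comment> \<open>Projecting the solution \<open>z\<close> to \<open>?R\<close> keeps
      \<open>A z\<close>: the remainder \<open>z - p\<close> is orthogonal to the range of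
      \<open>A\<close>, hence in its kernel.\<close>
    obtain p where p: "p \<in> ?R" "\<And>m. m \<in> ?R \<Longrightarrow> inner (z - p) m = 0"
      using ex_orthogonal_projection[OF subspace, of z] by auto
    have "inner (A (z - p)) w = 0" for w
      using p(2)[of "A w"] closure_subset[of "range A"] by (auto simp: sym)
    from this[of "A (z - p)"] have "A p = A z"
      by (simp add: diff)
    with p z show ?thesis by auto
  qed
  then obtain X where XR: "\<And>y. X y \<in> ?R" and AX: "\<And>y. A (X y) = cadjoint T (A y)"
    by metis
  have X_cinner: "cinner (A (X y)) z = cinner y (A (T z))" for y z
  proof -
    have "cinner (A (X y)) z = cnj (cinner z (cadjoint T (A y)))"
      unfolding AX by (rule cinner_commute)
    also have "\<dots> = cinner (A y) (T z)"
      unfolding adj[symmetric] by (rule cinner_commute[symmetric])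
    finally show ?thesis
      by (simp add: positive_op_symmetric[OF pos])
  qed
  have X_inner: "inner (X y) (A z) = inner y (A (T z))" for y z
    using X_cinner by (simp add: inner_eq_Re_cinner positive_op_symmetric[OF pos])
  \<comment> \<open>Linearity of \<open>X\<close> comes from uniqueness: a vector of
    \<open>?R\<close> with the defining identity of \<open>X y\<close> equals
    \<open>X y\<close>.\<close>
  have Reqf: "X y = u" if "u \<in> ?R" "\<And>z. cinner (A u) z = cinner y (A (T z))" for y u
    by (rule positive_op_inj_on_closure_range[OF pos _ XR that(1)])
      (rule cinner_ext_left, simp add: that(2) X_cinner)
  have R_C: "c *\<^sub>C u \<in> ?R" if "u \<in> ?R" for c u
  proof -
    have "(\<lambda>u. c *\<^sub>C u) ` ?R \<subseteq> closure ((\<lambda>u. c *\<^sub>C u) ` range A)"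
      by (intro closure_bounded_linear_image_subset bounded_linear_scaleC)
    also have "\<dots> \<subseteq> ?R"
      by (intro closure_mono) (auto simp flip: AC)
    finally show ?thesis
      using that by blast
  qed
  have X_add: "X (x + y) = X x + X y" for x y
    by (rule Reqf) (auto simp: subspace_add[OF subspace] XR add cinner_add_left X_cinner)
  have X_C: "X (c *\<^sub>C x) = c *\<^sub>C X x" for c x
    by (rule Reqf) (auto simp: R_C XR AC cinner_scaleC_left X_cinner)
  have "linear X"
    by (rule linearI) (simp_all add: X_add X_C scaleR_scaleC)
  moreover have "closed {y. norm (X y) \<le> real n}" for n
  proof -
    \<comment> \<open>It suffices to test \<open>X y\<close> against \<open>range A\<close>: the
      inequality passes to the closure, which contains \<open>X y\<close> itself. On
      \<open>range A\<close> the tested quantity is continuous in \<open>y\<close> before anything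
      is known about continuity of \<open>X\<close>.\<close>
    have "norm (X y) \<le> real n \<longleftrightarrow> (\<forall>z. inner y (A (T z)) \<le> real n * norm (A z))" for y
    proof
      assume "norm (X y) \<le> real n"
      then show "\<forall>z. inner y (A (T z)) \<le> real n * norm (A z)"
        unfolding X_inner[symmetric]
        by (meson mult_right_mono norm_cauchy_schwarz norm_ge_zero order_trans)
    next
      assume "\<forall>z. inner y (A (T z)) \<le> real n * norm (A z)"
      then have "?R \<subseteq> {v. inner (X y) v \<le> real n * norm v}"
        by (intro closure_minimal closed_Collect_le continuous_intros) (auto simp: X_inner)
      then have "inner (X y) (X y) \<le> real n * norm (X y)"
        using XR[of y] by blast
      then have "norm (X y) * norm (X y) \<le> real n * norm (X y)"
        by (simp only: power2_norm_eq_inner[symmetric] power2_eq_square)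
      then show "norm (X y) \<le> real n"
        by (cases "X y = 0") auto
    qed
    then have "{y. norm (X y) \<le> real n} = {y. \<forall>z. inner y (A (T z)) \<le> real n * norm (A z)}"
      by blast
    also have "closed \<dots>"
      by (intro closed_Collect_all closed_Collect_le continuous_intros)
    finally show ?thesis .
  qed
  ultimately have "bounded_linear X"
    by (rule bounded_linear_if_closed_sublevels)
  then have bX: "bounded_clinear X"
    unfolding bounded_clinear_def using X_C by blast
  have "sharp_A A T = X"
    unfolding sharp_A_def
  proof (rule the_equality)
    have "A \<circ> X = cadjoint T \<circ> A"
      by (rule ext) (simp only: comp_apply AX)
    then show "bounded_clinear X \<and> A \<circ> X = cadjoint T \<circ> A \<and> range X \<subseteq> ?R"
      using bX XR by blast
  next
    fix Y assume Y: "bounded_clinear Y \<and> A \<circ> Y = cadjoint T \<circ> A \<and> range Y \<subseteq> ?R"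
    show "Y = X"
    proof
      fix y
      have "A (Y y) = A (X y)"
        using Y AX[of y] by (metis comp_apply)
      moreover have "Y y \<in> ?R"
        using Y by blast
      ultimately show "Y y = X y"
        using positive_op_inj_on_closure_range[OF pos] XR[of y] by blast
    qed
  qed
  with bX AX show "bounded_clinear (sharp_A A T)" "A (sharp_A A T x) = cadjoint T (A x)"
    by simp_all
qed

lemma cinner_sharp:
  assumes "positive_op A" "T \<in> B_A A"
  shows "cinner (A (sharp_A A T x)) y = cinner (A x) (T y)"
    and "cinner (A (T x)) y = cinner (A x) (sharp_A A T y)"
proof -
  have "bounded_clinear T"
    using assms by (simp add: B_A_def)
  then have *: "cinner (A (sharp_A A T x)) y = cinner (A x) (T y)" for x y
    by (metis bounded_clinear_sharp(2)[OF assms] bounded_clinear_cinner_cadjoint cinner_commute)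
  then show "cinner (A (sharp_A A T x)) y = cinner (A x) (T y)" .
  show "cinner (A (T x)) y = cinner (A x) (sharp_A A T y)"
    by (metis * positive_op_symmetric[OF assms(1)] cinner_commute)
qed

section \<open>Weighted real parts of \<open>T\<close>\<close>

text \<open>Twice the A-real part of the operator \<open>cnj c\<close> times \<open>T\<close>.
  \<open>c = 1 / 2\<close> gives \<open>Re_A\<close>, \<open>c = \<i> / 2\<close> gives
  \<open>Im_A\<close>, and \<open>(1 + \<i>) / 2\<close> and its conjugate give their sum and
  difference, so one family serves both the finiteness of the numerical radius and the final
  estimate.\<close>

definition weighted_Re_A ::
  "complex \<Rightarrow> ('a::complex_hilbert_space \<Rightarrow> 'a) \<Rightarrow> ('a \<Rightarrow> 'a) \<Rightarrow> 'a \<Rightarrow> 'a"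
  where "weighted_Re_A c A T x = cnj c *\<^sub>C T x + c *\<^sub>C sharp_A A T x"

lemma bounded_linear_weighted_Re_A:
  assumes "positive_op A" "T \<in> B_A A"
  shows "bounded_linear (weighted_Re_A c A T)"
proof -
  have "bounded_linear T" "bounded_linear (sharp_A A T)"
    using assms bounded_clinear_sharp(1)[OF assms] by (auto simp: B_A_def bounded_clinear_def)
  then show ?thesis
    unfolding weighted_Re_A_def
    by (intro bounded_linear_add bounded_linear_compose[OF bounded_linear_scaleC])
qed

lemma cinner_A_weighted_Re_A:
  assumes "positive_op A" "T \<in> B_A A"
  shows "cinner (A (weighted_Re_A c A T x)) y
    = cnj c * cinner (A (T x)) y + c * cinner (A (sharp_A A T x)) y"
proof -
  interpret bounded_linear A
    using assms by (simp add: positive_op_def bounded_clinear_def)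
  have "A (c *\<^sub>C x) = c *\<^sub>C A x" for c x
    using assms by (simp add: positive_op_def bounded_clinear_def)
  then show ?thesis
    by (simp add: weighted_Re_A_def add cinner_add_left cinner_scaleC_left)
qed

text \<open>Adjointness moves each summand across into the other one, with its coefficient
  conjugated.\<close>

lemma weighted_Re_A_symmetric:
  assumes "positive_op A" "T \<in> B_A A"
  shows "inner (A (weighted_Re_A c A T x)) y = inner (A x) (weighted_Re_A c A T y)"
  by (simp add: inner_eq_Re_cinner cinner_A_weighted_Re_A[OF assms] cinner_sharp[OF assms])
    (simp add: weighted_Re_A_def cinner_add_right cinner_scaleC_right)

lemma weighted_Re_A_quadratic_form:
  assumes "positive_op A" "T \<in> B_A A"
  shows "inner (A (weighted_Re_A c A T z)) z = 2 * Re (cnj c * inner_A A (T z) z)"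
proof -
  have "cinner (A (sharp_A A T z)) z = cnj (cinner (A (T z)) z)"
    by (metis cinner_sharp(1)[OF assms] positive_op_cinner_commute[OF assms(1)])
  then show ?thesis
    by (simp add: inner_eq_Re_cinner cinner_A_weighted_Re_A[OF assms] inner_A_def)
qed

text \<open>The real and imaginary parts of the form of \<open>T\<close> are forms of symmetric
  operators, to which the seminorm bound and Cauchy-Schwarz apply. The inequality for all
  \<open>z\<close> also makes the form vanish at null vectors.\<close>

lemma num_radius_A_bounded:
  assumes "positive_op A" "T \<in> B_A A"
  shows "\<exists>K. \<forall>z. cmod (inner_A A (T z) z) \<le> K * (norm_A A z)\<^sup>2"
proof -
  interpret semi_inner A
    using assms(1) by (rule positive_op_semi_inner)
  have "\<exists>K. \<forall>z. \<bar>2 * Re (cnj c * inner_A A (T z) z)\<bar> \<le> K * (snorm z)\<^sup>2" for c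
  proof -
    obtain K where K: "\<And>z. snorm (weighted_Re_A c A T z) \<le> K * snorm z"
      using symmetric_snorm_bounded[OF bounded_linear_weighted_Re_A[OF assms]
          weighted_Re_A_symmetric[OF assms]] by blast
    have "\<bar>2 * Re (cnj c * inner_A A (T z) z)\<bar> \<le> snorm (weighted_Re_A c A T z) * snorm z" for z
      by (metis Cauchy_Schwarz_abs weighted_Re_A_quadratic_form[OF assms])
    also have "\<dots>z \<le> K * (snorm z)\<^sup>2" for z
      using mult_right_mono[OF K[of z] snorm_nonneg[of z]] by (simp add: power2_eq_square mult.assoc)
    finally show ?thesis by blast
  qed
  \<comment> \<open>These weights isolate the real and the imaginary part of
    \<open>inner_A A (T z) z\<close>.\<close>
  from this[of "1/2"] this[of "\<i>/2"] obtain K L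
    where "\<And>z. \<bar>Re (inner_A A (T z) z)\<bar> \<le> K * (snorm z)\<^sup>2"
      "\<And>z. \<bar>Im (inner_A A (T z) z)\<bar> \<le> L * (snorm z)\<^sup>2"
    by auto
  then have "cmod (inner_A A (T z) z) \<le> (K + L) * (norm_A A z)\<^sup>2" for z
    unfolding norm_A_eq_snorm[OF assms(1)] distrib_right
    by (rule order_trans[OF cmod_le add_mono])
  then show ?thesis by blast
qed

section \<open>Suprema and the numerical radius\<close>

lemma sup_nonneg_upper: "bdd_above S \<Longrightarrow> s \<in> S \<Longrightarrow> s \<le> sup_nonneg S"
  by (auto simp: sup_nonneg_def intro: cSup_upper)

text \<open>\<open>0 \<le> K\<close> covers the empty set, whose supremum is set to 0.\<close>

lemma sup_nonneg_least: "0 \<le> K \<Longrightarrow> (\<And>s. s \<in> S \<Longrightarrow> s \<le> K) \<Longrightarrow> sup_nonneg S \<le> K"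
  by (auto simp: sup_nonneg_def intro: cSup_least)

lemma sup_nonneg_nonneg: "bdd_above S \<Longrightarrow> (\<And>s. s \<in> S \<Longrightarrow> 0 \<le> s) \<Longrightarrow> 0 \<le> sup_nonneg S"
  by (cases "S = {}") (auto simp: sup_nonneg_def intro: cSup_upper2)

text \<open>Homogeneity extends the bound from unit vectors to all vectors of nonzero seminorm; at
  null vectors the finite bound \<open>K\<close> makes the form zero.\<close>

lemma num_radius_A_upper:
  assumes "positive_op A" "T \<in> B_A A"
  shows "0 \<le> num_radius_A A T"
    and "cmod (inner_A A (T z) z) \<le> num_radius_A A T * (norm_A A z)\<^sup>2"
proof -
  interpret semi_inner A
    using assms(1) by (rule positive_op_semi_inner)
  interpret T: bounded_linear T
    using assms by (simp add: B_A_def bounded_clinear_def)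
  note norm_A = norm_A_eq_snorm[OF assms(1)]
  let ?S = "{cmod (inner_A A (T x) x) | x. norm_A A x = 1}"
  obtain K where K: "\<And>z. cmod (inner_A A (T z) z) \<le> K * (norm_A A z)\<^sup>2"
    using num_radius_A_bounded[OF assms] by blast
  have bdd: "bdd_above ?S"
  proof (rule bdd_aboveI)
    fix s assume "s \<in> ?S"
    then obtain x where "s = cmod (inner_A A (T x) x)" "norm_A A x = 1"
      by blast
    then show "s \<le> K"
      using K[of x] by simp
  qed
  then show "0 \<le> num_radius_A A T"
    unfolding num_radius_A_def by (rule sup_nonneg_nonneg) auto
  show "cmod (inner_A A (T z) z) \<le> num_radius_A A T * (norm_A A z)\<^sup>2"
  proof (cases "norm_A A z = 0")
    case True
    then show ?thesis
      using K[of z] by simp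
  next
    case False
    define r where "r = inverse (norm_A A z)"
    have "norm_A A (r *\<^sub>R z) = 1"
      using False snorm_normalize[of z] by (simp add: r_def norm_A)
    then have "cmod (inner_A A (T (r *\<^sub>R z)) (r *\<^sub>R z)) \<le> num_radius_A A T"
      unfolding num_radius_A_def by (intro sup_nonneg_upper[OF bdd]) auto
    moreover have "inner_A A (T (r *\<^sub>R z)) (r *\<^sub>R z) = of_real (r\<^sup>2) * inner_A A (T z) z"
      by (simp add: inner_A_def T.scaleR scaleR)
        (simp add: scaleR_scaleC cinner_scaleC_left cinner_scaleC_right power2_eq_square)
    ultimately have "r\<^sup>2 * cmod (inner_A A (T z) z) \<le> num_radius_A A T"
      by (simp add: norm_mult norm_power)
    then show ?thesis
      using False by (simp add: r_def field_simps)
  qed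
qed

lemma norm_A_weighted_Re_A_le:
  assumes "positive_op A" "T \<in> B_A A"
  shows "norm_A A (weighted_Re_A c A T x) \<le> 2 * cmod c * num_radius_A A T * norm_A A x"
proof -
  interpret semi_inner A
    using assms(1) by (rule positive_op_semi_inner)
  note norm_A = norm_A_eq_snorm[OF assms(1)]
  have "\<bar>inner (A (weighted_Re_A c A T z)) z\<bar> \<le> 2 * cmod c * num_radius_A A T * (snorm z)\<^sup>2" for z
  proof -
    have "\<bar>inner (A (weighted_Re_A c A T z)) z\<bar> = 2 * \<bar>Re (cnj c * inner_A A (T z) z)\<bar>"
      by (simp only: weighted_Re_A_quadratic_form[OF assms] abs_mult abs_numeral)
    also have "\<dots> \<le> 2 * (cmod c * cmod (inner_A A (T z) z))"
      using abs_Re_le_cmod[of "cnj c * inner_A A (T z) z"] by (simp only: norm_mult complex_mod_cnj)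
    also have "\<dots> \<le> 2 * (cmod c * (num_radius_A A T * (snorm z)\<^sup>2))"
      using num_radius_A_upper(2)[OF assms, of z] by (simp add: norm_A mult_left_mono)
    finally show ?thesis by (simp add: mult.assoc)
  qed
  from symmetric_snorm_le_quadratic_form[OF bounded_linear_weighted_Re_A[OF assms]
      weighted_Re_A_symmetric[OF assms] this]
  show ?thesis
    by (simp add: norm_A)
qed

section \<open>The operator seminorm\<close>

lemma norm_A_scaleC:
  assumes "positive_op A"
  shows "norm_A A (c *\<^sub>C x) = cmod c * norm_A A x"
proof -
  have "A (c *\<^sub>C x) = c *\<^sub>C A x"
    using assms by (simp add: positive_op_def bounded_clinear_def)
  then have "inner_A A (c *\<^sub>C x) (c *\<^sub>C x) = of_real ((cmod c)\<^sup>2) * inner_A A x x"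
    by (simp add: inner_A_def cinner_scaleC_left cinner_scaleC_right complex_norm_square
        del: of_real_power)
  then show ?thesis
    by (simp add: norm_A_def real_sqrt_mult del: of_real_power)
qed

text \<open>Finiteness is what lets the supremum in \<open>opnorm_A\<close> dominate the values it
  is taken over.\<close>

lemma opnorm_A_bdd_above:
  assumes "\<And>x. norm_A A (S x) \<le> K * norm_A A x"
  shows "bdd_above {norm_A A (S x) | x. x \<in> closure (range A) \<and> norm_A A x = 1}"
proof (rule bdd_aboveI)
  fix s assume "s \<in> {norm_A A (S x) | x. x \<in> closure (range A) \<and> norm_A A x = 1}"
  then obtain x where "s = norm_A A (S x)" "norm_A A x = 1"
    by blast
  then show "s \<le> K"
    using assms[of x] by simp
qed

lemma opnorm_A_upper:
  assumes "\<And>x. norm_A A (S x) \<le> K * norm_A A x"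
    and "x \<in> closure (range A)" "norm_A A x = 1"
  shows "norm_A A (S x) \<le> opnorm_A A S"
  unfolding opnorm_A_def
  by (rule sup_nonneg_upper[OF opnorm_A_bdd_above[OF assms(1)]]) (use assms(2,3) in auto)

lemma opnorm_A_nonneg:
  assumes "positive_op A" "\<And>x. norm_A A (S x) \<le> K * norm_A A x"
  shows "0 \<le> opnorm_A A S"
  unfolding opnorm_A_def
  by (rule sup_nonneg_nonneg[OF opnorm_A_bdd_above[OF assms(2)]])
    (auto simp: norm_A_eq_snorm[OF assms(1)]
      semi_inner.snorm_nonneg[OF positive_op_semi_inner[OF assms(1)]])

lemma opnorm_A_least:
  assumes "0 \<le> K" "\<And>x. x \<in> closure (range A) \<Longrightarrow> norm_A A x = 1 \<Longrightarrow> norm_A A (S x) \<le> K"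
  shows "opnorm_A A S \<le> K"
  unfolding opnorm_A_def by (rule sup_nonneg_least) (use assms in auto)

theorem theorem2p9:
  fixes A T :: "'a::complex_hilbert_space \<Rightarrow> 'a"
  assumes "positive_op A"
    and "T \<in> B_A A"
  shows "num_radius_A A T \<ge> opnorm_A A T / 2
    + \<bar>opnorm_A A (\<lambda>x. Re_A A T x + Im_A A T x) - opnorm_A A (\<lambda>x. Re_A A T x - Im_A A T x)\<bar>
        / (2 * sqrt 2)"
proof -
  interpret semi_inner A
    using assms(1) by (rule positive_op_semi_inner)
  note norm_A = norm_A_eq_snorm[OF assms(1)]
  let ?c = "(1 + \<i>) / 2" and ?w = "num_radius_A A T"
  let ?P = "weighted_Re_A ?c A T" and ?Q = "weighted_Re_A (cnj ?c) A T"
  let ?p = "opnorm_A A ?P" and ?q = "opnorm_A A ?Q"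
  \<comment> \<open>This modulus enters twice: as \<open>2 * cmod ?c = sqrt 2\<close> in the bounds
    of \<open>?P\<close> and \<open>?Q\<close>, and as the weight \<open>1 / sqrt 2\<close> in the
    splitting of \<open>T\<close>.\<close>
  have cmod: "cmod ?c = 1 / sqrt 2" "cmod (cnj ?c) = 1 / sqrt 2"
    by (simp_all add: cmod_def power2_eq_square real_sqrt_divide)
  have coeffs: "1 / 2 + 1 / (2 * \<i>) = cnj ?c" "1 / 2 - 1 / (2 * \<i>) = ?c"
    by (simp_all add: complex_eq_iff)
  have scaleC_diff_left: "(c - d) *\<^sub>C x = c *\<^sub>C x - d *\<^sub>C x" for c d and x :: 'a
    using scaleC_add_left[of "c - d" d x] by (simp add: algebra_simps)
  have P: "(\<lambda>x. Re_A A T x + Im_A A T x) = ?P"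
    unfolding weighted_Re_A_def Re_A_def Im_A_def coeffs[symmetric]
    by (simp add: scaleC_add_left scaleC_diff_left scaleC_add_right scaleC_diff_right algebra_simps)
  have Q: "(\<lambda>x. Re_A A T x - Im_A A T x) = ?Q"
    unfolding weighted_Re_A_def Re_A_def Im_A_def complex_cnj_cnj coeffs[symmetric]
    by (simp add: scaleC_add_left scaleC_diff_left scaleC_add_right scaleC_diff_right algebra_simps)
  have T_eq: "T x = ?c *\<^sub>C ?P x + cnj ?c *\<^sub>C ?Q x" for x
  proof -
    \<comment> \<open>\<open>?c * ?c = \<i> / 2\<close>, so the two squares cancel, while
      \<open>2 * (cmod ?c)\<^sup>2 = 1\<close>: exactly \<open>T x\<close> survives.\<close>
    have "?c * cnj ?c + cnj ?c * ?c = 1" "?c * ?c + cnj ?c * cnj ?c = 0"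
      by (simp_all add: complex_eq_iff)
    moreover have "?c *\<^sub>C ?P x + cnj ?c *\<^sub>C ?Q x
      = (?c * cnj ?c + cnj ?c * ?c) *\<^sub>C T x + (?c * ?c + cnj ?c * cnj ?c) *\<^sub>C sharp_A A T x"
      by (simp only: weighted_Re_A_def scaleC_add_right scaleC_scaleC scaleC_add_left complex_cnj_cnj)
        (simp add: algebra_simps)
    ultimately have "?c *\<^sub>C ?P x + cnj ?c *\<^sub>C ?Q x = 1 *\<^sub>C T x + 0 *\<^sub>C sharp_A A T x"
      by (simp only:)
    then show ?thesis
      using scaleR_scaleC[of 0 "sharp_A A T x"] by (simp only: scaleC_one) simp
  qed
  have w: "0 \<le> ?w"
    by (rule num_radius_A_upper[OF assms])
  \<comment> \<open>These bounds serve twice: they make the suprema \<open>?p\<close> and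
    \<open>?q\<close> finite and bound them by \<open>sqrt 2 * ?w\<close>.\<close>
  have P_le: "norm_A A (?P x) \<le> sqrt 2 * ?w * norm_A A x"
    and Q_le: "norm_A A (?Q x) \<le> sqrt 2 * ?w * norm_A A x" for x
    using norm_A_weighted_Re_A_le[OF assms, of ?c x] norm_A_weighted_Re_A_le[OF assms, of "cnj ?c" x]
    unfolding cmod by (simp_all add: real_div_sqrt)
  \<comment> \<open>Nonnegativity of \<open>?w\<close> covers the case in which no vector has
    seminorm 1.\<close>
  have p: "?p \<le> sqrt 2 * ?w" and q: "?q \<le> sqrt 2 * ?w"
    using w P_le Q_le by (auto intro!: opnorm_A_least) (metis mult.right_neutral)+
  have pq: "0 \<le> ?p" "0 \<le> ?q"
    by (rule opnorm_A_nonneg[OF assms(1) P_le], rule opnorm_A_nonneg[OF assms(1) Q_le])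
  have "opnorm_A A T \<le> (?p + ?q) / sqrt 2"
  proof (rule opnorm_A_least)
    fix x assume x: "x \<in> closure (range A)" "norm_A A x = 1"
    have "norm_A A (T x) \<le> norm_A A (?c *\<^sub>C ?P x) + norm_A A (cnj ?c *\<^sub>C ?Q x)"
      unfolding T_eq[of x] norm_A by (rule snorm_triangle)
    also have "\<dots> = (norm_A A (?P x) + norm_A A (?Q x)) / sqrt 2"
      unfolding norm_A_scaleC[OF assms(1)] cmod by (simp add: add_divide_distrib)
    also have "\<dots> \<le> (?p + ?q) / sqrt 2"
      by (intro divide_right_mono add_mono opnorm_A_upper[OF P_le x] opnorm_A_upper[OF Q_le x]) simp
    finally show "norm_A A (T x) \<le> (?p + ?q) / sqrt 2" .
  qed (use pq in simp)
  then have "opnorm_A A T / 2 + \<bar>?p - ?q\<bar> / (2 * sqrt 2)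
    \<le> (?p + ?q) / sqrt 2 / 2 + \<bar>?p - ?q\<bar> / (2 * sqrt 2)"
    by (intro add_right_mono divide_right_mono) simp_all
  also have "\<dots> = ((?p + ?q + \<bar>?p - ?q\<bar>) / 2) / sqrt 2"
    by (simp add: add_divide_distrib)
  also have "(?p + ?q + \<bar>?p - ?q\<bar>) / 2 = max ?p ?q"
    by (simp add: max_def)
  also have "max ?p ?q / sqrt 2 \<le> ?w"
    using max.boundedI[OF p q] by (simp only: pos_divide_le_eq real_sqrt_gt_0_iff zero_less_numeral mult.commute)
  finally show ?thesis
    unfolding P Q .
qed

end
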